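(* There exist constants $c,C>0$ such that for all integers $n\geq 2$, \[ D(n,3)\geq c\,\frac{n^2}{e^{C\sqrt{\log n}}}, \] i.e. $D(n,3)=\Omega\big(n^2/e^{O(\sqrt{\log n})}\big)$.
   Context: All graphs are finite, simple and undirected. For a graph $G$ and an integer $k\geq 1$, the $k$-configuration graph $\mathcal{R}_k(G)$ (token jumping model) is the graph whose vertices are the independent sets of $G$ of size exactly $k$, where two such independent sets $I,J$ are adjacent if and only if $|I\cap J|=k-1$. $D(n,k)$ denotes the maximum, over all graphs $G$ on $n$ vertices, of the largest diameter of a connected component of $\mathcal{R}_k(G)$.
   Formalization: The bound is stated for all n ≥ 4 rather than n ≥ 2, since for n = 3 the configuration graph has at most one vertex, so D(3,3) = 0 while the right-hand side is positive, and for n = 2 there are no independent sets of size 3. *)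

theory Defs
  imports "Graph_Theory.Graph_Theory" Complex_Main
begin

text \<open>
  Finite simple undirected graphs are the \<^locale>\<open>pair_graph\<close>s: finite, loop-free and
  symmetric sets of ordered pairs, so that an undirected edge \<open>uv\<close> is the pair of arcs
  \<open>(u,v)\<close>, \<open>(v,u)\<close>.
\<close>

definition independent_set :: "'a pair_pre_digraph \<Rightarrow> 'a set \<Rightarrow> bool" where
  "independent_set G I \<longleftrightarrow> I \<subseteq> pverts G \<and> (\<forall>u\<in>I. \<forall>v\<in>I. (u, v) \<notin> parcs G)"

text \<open>
  The condition \<open>|I \<inter> J| = k - 1\<close> is written without the truncated subtraction.
\<close>

definition config_graph :: "nat \<Rightarrow> 'a pair_pre_digraph \<Rightarrow> 'a set pair_pre_digraph" where
  "config_graph k G =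
     (let S = {I. independent_set G I \<and> card I = k}
      in \<lparr> pverts = S, parcs = {(I, J). I \<in> S \<and> J \<in> S \<and> card (I \<inter> J) + 1 = k} \<rparr>)"

text \<open>
  With unit arc costs, \<open>wf_digraph.\<mu>\<close> (the infimum of the costs of all walks between two
  vertices) is the usual graph distance.
\<close>

definition graph_diameter :: "('a, 'b) pre_digraph \<Rightarrow> ereal" where
  "graph_diameter H = (SUP u\<in>verts H. SUP v\<in>verts H. wf_digraph.\<mu> H (\<lambda>_. 1) u v)"

text \<open>
  In a symmetric graph the strongly connected components \<open>pre_digraph.sccs\<close> are the connected
  components. Taking the vertices to be natural numbers loses nothing, as every finite graph
  is isomorphic to such a graph. The supremum is attained for \<open>1 \<le> k \<le> n\<close>
  (\<open>max_config_diameter_attained\<close> below). For \<open>k > n\<close> there are no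
  components at all and the value is \<open>-\<infinity>\<close>, the supremum of the empty set in \<^typ>\<open>ereal\<close>.
\<close>

definition max_config_diameter :: "nat \<Rightarrow> nat \<Rightarrow> ereal" where
  "max_config_diameter n k =
     (SUP G\<in>{G :: nat pair_pre_digraph. pair_graph G \<and> card (pverts G) = n}.
      SUP H\<in>pre_digraph.sccs (with_proj (config_graph k G)). graph_diameter H)"


lemma pair_graph_config_graph:
  assumes "pair_graph G"
  shows "pair_graph (config_graph k G)"
proof -
  interpret pair_graph G by fact
  let ?R = "config_graph k G"
  have verts: "pverts ?R \<subseteq> Pow (pverts G)"
    by (auto simp: config_graph_def independent_set_def)
  have arcs: "e \<in> parcs ?R \<longleftrightarrow> fst e \<in> pverts ?R \<and> snd e \<in> pverts ?R
      \<and> card (fst e \<inter> snd e) + 1 = k" for e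
    by (cases e) (simp add: config_graph_def)
  have loop: "card I = k" if "I \<in> pverts ?R" for I
    using that by (simp add: config_graph_def)
  have fin: "finite (pverts ?R)"
    using finite_subset[OF verts] pair_finite_verts by simp
  have "parcs ?R \<subseteq> pverts ?R \<times> pverts ?R"
    using arcs by (metis mem_Times_iff subsetI)
  then have fin': "finite (parcs ?R)"
    using fin by (metis finite_cartesian_product finite_subset)
  have sym: "symmetric (with_proj ?R)"
    unfolding symmetric_def with_proj_simps by (rule symI) (simp add: arcs Int_commute)
  show ?thesis
  proof
    show "fst e \<noteq> snd e" if "e \<in> parcs ?R" for e
    proof
      assume "fst e = snd e"
      with that have "card (snd e) + 1 = k" "snd e \<in> pverts ?R" by (simp_all add: arcs)
      with loop show False by simp
    qed
  qed (use arcs fin fin' sym in blast)+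
qed

lemma finite_Sup_mem:
  fixes A :: "ereal set"
  assumes "finite A" "A \<noteq> {}"
  shows "Sup A \<in> A"
  using Max_in[OF assms] Max_Sup[OF assms] by simp

lemma scc_diameter_cases:
  assumes G: "pair_graph G" and H: "H \<in> pre_digraph.sccs (with_proj G)"
  shows "graph_diameter H \<in> ereal ` real ` {..card (pverts G)}"
proof -
  interpret pair_graph G by fact
  have ind: "induced_subgraph H (with_proj G)" and sc: "strongly_connected H"
    using H by (auto simp: pre_digraph.sccs_def)
  have sub: "subgraph H (with_proj G)" using ind by (simp add: induced_subgraph_def)
  have "wf_digraph H" using sub by (simp add: subgraph_def)
  moreover have "verts H \<subseteq> pverts G" "arcs H \<subseteq> parcs G"
    using sub by (simp_all add: subgraph_def)
  then have "finite (verts H)" "finite (arcs H)"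
    using pair_finite_verts pair_finite_arcs by (metis finite_subset)+
  ultimately have "fin_digraph H"
    by (intro fin_digraph.intro fin_digraph_axioms.intro)
  then interpret H: fin_digraph H .
  have cost: "H.awalk_cost (\<lambda>_. 1) p = real (length p)" for p
    by (induction p) auto
  have le: "card (verts H) \<le> card (pverts G)"
    using sub pair_finite_verts by (auto simp: subgraph_def intro: card_mono)
  have mu: "H.\<mu> (\<lambda>_. 1) u v \<in> ereal ` real ` {..card (pverts G)}"
    if uv: "u \<in> verts H" "v \<in> verts H" for u v
  proof -
    have "u \<rightarrow>\<^sup>*\<^bsub>H\<^esub> v" using sc uv by (auto simp: strongly_connected_def)
    then obtain p where p: "H.apath u p v" "H.\<mu> (\<lambda>_. 1) u v = H.awalk_cost (\<lambda>_. 1) p"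
      using H.min_cost_awalk[of u v "\<lambda>_. 1"] by auto
    have "length p \<le> card (verts H)"
      using H.length_apath_less[OF p(1)] by simp
    with p(2) le show ?thesis by (auto simp: cost)
  qed
  let ?g = "\<lambda>u. SUP v\<in>verts H. H.\<mu> (\<lambda>_. 1) u v"
  have ne: "verts H \<noteq> {}" using sc by (simp add: strongly_connected_def)
  have g: "?g u \<in> ereal ` real ` {..card (pverts G)}" if "u \<in> verts H" for u
  proof -
    have "?g u \<in> H.\<mu> (\<lambda>_. 1) u ` verts H"
      by (rule finite_Sup_mem) (use ne in auto)
    with mu that show ?thesis by auto
  qed
  have "graph_diameter H \<in> ?g ` verts H"
    unfolding graph_diameter_def by (rule finite_Sup_mem) (use ne in auto)
  then obtain u where "u \<in> verts H" "graph_diameter H = ?g u" by (rule imageE)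
  with g show ?thesis by (simp only:)
qed

lemma sccs_nonempty:
  assumes "pair_graph G" and "pverts G \<noteq> {}"
  shows "pre_digraph.sccs (with_proj G) \<noteq> {}"
proof -
  interpret pair_graph G by fact
  obtain u where "u \<in> pverts G" using assms(2) by blast
  then have "scc_of u \<in> sccs_verts"
    using scc_of_in_sccs_verts by simp
  then show ?thesis using sccs_verts_conv by auto
qed

lemma max_config_diameter_attained:
  assumes "1 \<le> k" "k \<le> n"
  obtains G :: "nat pair_pre_digraph" and H and d :: nat
  where "pair_graph G" "card (pverts G) = n"
    and "H \<in> pre_digraph.sccs (with_proj (config_graph k G))"
    and "graph_diameter H = ereal (real d)" "max_config_diameter n k = ereal (real d)"
proof -
  let ?GS = "{G :: nat pair_pre_digraph. pair_graph G \<and> card (pverts G) = n}"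
  let ?CS = "\<lambda>G :: nat pair_pre_digraph. pre_digraph.sccs (with_proj (config_graph k G))"
  let ?D = "(\<Union>G\<in>?GS. graph_diameter ` ?CS G)"
  have D: "max_config_diameter n k = Sup ?D"
    unfolding max_config_diameter_def
    by (rule antisym) (auto intro!: SUP_least Sup_least intro: Sup_upper SUP_upper2)
  have bound: "graph_diameter H \<in> ereal ` real ` {..n choose k}"
    if "G \<in> ?GS" "H \<in> ?CS G" for G H
  proof -
    have fin: "finite (pverts G)" and G: "pair_graph G" and n: "card (pverts G) = n"
      using that by (auto simp: pair_graph.axioms pair_graph_def pair_digraph_def
          pair_fin_digraph.pair_finite_verts)
    have "card (pverts (config_graph k G)) \<le> card {I. I \<subseteq> pverts G \<and> card I = k}"
      using fin by (intro card_mono) (auto simp: config_graph_def independent_set_def)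
    also have "\<dots> = n choose k" using n_subsets[OF fin] n by simp
    finally show ?thesis
      using scc_diameter_cases[OF pair_graph_config_graph[OF G], of H k] that by auto
  qed
  then have "?D \<subseteq> ereal ` real ` {..n choose k}" by blast
  then have fin: "finite ?D" by (rule finite_subset) simp
  define E where "E = \<lparr> pverts = {..<n}, parcs = {} :: (nat \<times> nat) set \<rparr>"
  have E: "E \<in> ?GS"
    unfolding E_def by (simp, unfold_locales) (auto simp: symmetric_def sym_def)
  have "{..<k} \<in> pverts (config_graph k E)"
    using \<open>k \<le> n\<close> by (auto simp: config_graph_def independent_set_def E_def)
  then have "?CS E \<noteq> {}"
    using E by (intro sccs_nonempty pair_graph_config_graph) auto
  with E have "?D \<noteq> {}" by blast
  from finite_Sup_mem[OF fin this] obtain G H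
    where GH: "G \<in> ?GS" "H \<in> ?CS G" "Sup ?D = graph_diameter H" by blast
  from bound[OF GH(1,2)] obtain d :: nat where "graph_diameter H = ereal (real d)" by blast
  with GH D show ?thesis using that by auto
qed

text \<open>
  With at most \<open>k\<close> vertices, the configuration graph has at most one vertex, so that no
  positive lower bound on the diameter can hold for \<open>n \<le> k\<close>; for \<open>k = 3\<close> a bound must start at \<open>n = 4\<close>.
\<close>

lemma max_config_diameter_le_0:
  assumes "1 \<le> k" "n \<le> k"
  shows "max_config_diameter n k \<le> 0"
  unfolding max_config_diameter_def
proof (intro SUP_least)
  fix G :: "nat pair_pre_digraph" and H
  assume G: "G \<in> {G. pair_graph G \<and> card (pverts G) = n}"
    and H: "H \<in> pre_digraph.sccs (with_proj (config_graph k G))"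
  interpret pair_graph G using G by simp
  have sub: "subgraph H (with_proj (config_graph k G))"
    using H by (auto simp: pre_digraph.sccs_def induced_subgraph_def)
  interpret H: wf_digraph H using sub by (simp add: subgraph_def)
  have "I = pverts G" if "I \<in> verts H" for I
  proof -
    have "I \<in> pverts (config_graph k G)" using sub that by (auto simp: subgraph_def)
    then have "I \<subseteq> pverts G" "card I = k"
      by (auto simp: config_graph_def independent_set_def)
    moreover have "card (pverts G) \<le> k" using G assms by simp
    ultimately show ?thesis using card_seteq[OF pair_finite_verts] by metis
  qed
  then have eq: "u = v" if "u \<in> verts H" "v \<in> verts H" for u v
    using that by metis
  have self: "H.\<mu> (\<lambda>_. 1) u u \<le> 0" if "u \<in> verts H" for u
    using H.min_cost_le_walk_cost[of u "[]" u "\<lambda>_. 1"] that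
    by (simp add: H.awalk_Nil_iff zero_ereal_def)
  show "graph_diameter H \<le> 0"
    unfolding graph_diameter_def
  proof (intro SUP_least)
    fix u v assume "u \<in> verts H" "v \<in> verts H"
    with eq self show "H.\<mu> (\<lambda>_. 1) u v \<le> 0" by metis
  qed
qed

end

(*
  Independent triples of G are the triangles of the complement H, and two of them are adjacent when
  the triangles share an edge. Let H be a "strip", that is the square of a walk v_0, v_1, ...: edges
  v_t v_{t+1} and v_t v_{t+2}. If no edge is repeated and H has no triangles besides
  {v_t, v_{t+1}, v_{t+2}}, then each reconfiguration step changes t by at most one, so the
  diameter is the length of the strip.

  Long strips come from the Ruzsa-Szemeredi graph. Given a 3-AP-free set A of numbers below M,
  the triangles (x, x + 4a, x + 8a) with a in A in a tripartite graph are edge-disjoint and there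
  are no others. For fixed a, the sequence x, x + 4a, x + 8a, x + 1, x + 1 + 4a, x + 1 + 8a, ...
  makes them part of one strip; it shifts some differences by 1, and the factor 4 keeps these from
  creating new triangles. Running through x < 20 M for one a after the other gives a strip with
  about M card A triangles on O(M) vertices, and Behrend's construction provides A with
  M / exp(O(sqrt(log M))) elements.
*)
theory Submission
  imports Defs "HOL-Library.FuncSet"
begin

section \<open>Strips of triangles\<close>

text \<open>The walk has the \<open>T + 2\<close> terms \<open>v 0\<close>, ...,
  \<open>v (T + 1)\<close>, hence exactly \<open>T\<close> windows of three consecutive
  terms.\<close>

definition strip_adj :: "(nat \<Rightarrow> 'a) \<Rightarrow> nat \<Rightarrow> 'a \<Rightarrow> 'a \<Rightarrow> bool" where
  "strip_adj v T p q \<longleftrightarrow> (\<exists>t d. d \<in> {1, 2} \<and> t + d < T + 2 \<and> {p, q} = {v t, v (t + d)})"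

definition strip_triangle :: "(nat \<Rightarrow> 'a) \<Rightarrow> nat \<Rightarrow> 'a set" where
  "strip_triangle v t = {v t, v (t + 1), v (t + 2)}"

definition co_strip :: "(nat \<Rightarrow> 'a) \<Rightarrow> nat \<Rightarrow> 'a set \<Rightarrow> 'a pair_pre_digraph" where
  "co_strip v T V = \<lparr> pverts = V, parcs = {(p, q). p \<in> V \<and> q \<in> V \<and> p \<noteq> q \<and> \<not> strip_adj v T p q} \<rparr>"

lemma strip_adj_sym: "strip_adj v T p q \<longleftrightarrow> strip_adj v T q p"
  by (simp add: strip_adj_def insert_commute)

lemma strip_adjI1: "t + 1 < T + 2 \<Longrightarrow> strip_adj v T (v t) (v (t + 1))"
  unfolding strip_adj_def by blast

lemma strip_adjI2: "t < T \<Longrightarrow> strip_adj v T (v t) (v (t + 2))"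
  unfolding strip_adj_def by (rule exI[of _ t], rule exI[of _ 2]) simp

lemma pair_graph_co_strip: "finite V \<Longrightarrow> pair_graph (co_strip v T V)"
proof (unfold_locales, goal_cases)
  case 4
  from \<open>finite V\<close> have "finite (V \<times> V)" by simp
  then show ?case
    by (rule finite_subset[rotated, of "V \<times> V"]) (auto simp: co_strip_def)
qed (auto simp: co_strip_def symmetric_def sym_def strip_adj_sym)

text \<open>The walk may revisit vertices; only its edges must not recur. This leaves room for
  \<open>T\<close> to be quadratic in \<open>card V\<close>.\<close>

locale strip =
  fixes v :: "nat \<Rightarrow> 'a" and T :: nat and V :: "'a set"
  assumes fin: "finite V" and pos: "0 < T"
    and range: "t < T + 2 \<Longrightarrow> v t \<in> V"
    and proper: "d \<in> {1, 2} \<Longrightarrow> t + d < T + 2 \<Longrightarrow> v t \<noteq> v (t + d)"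
    and edge_unique: "\<lbrakk>d \<in> {1, 2}; e \<in> {1, 2}; s + d < T + 2; t + e < T + 2;
      {v s, v (s + d)} = {v t, v (t + e)}\<rbrakk> \<Longrightarrow> s = t"
    and triangle: "\<lbrakk>strip_adj v T p q; strip_adj v T q r; strip_adj v T p r\<rbrakk> \<Longrightarrow>
      \<exists>t<T. {p, q, r} = strip_triangle v t"
begin

section \<open>Reconfiguration of the triangles of a strip\<close>

abbreviation R :: "'a set pair_pre_digraph" where
  "R \<equiv> config_graph 3 (co_strip v T V)"

lemma pair_graph_R: "pair_graph R"
  by (rule pair_graph_config_graph[OF pair_graph_co_strip[OF fin]])

lemma pverts_R: "pverts R = strip_triangle v ` {..<T}"
proof (intro equalityI subsetI)
  fix I assume "I \<in> pverts R"
  then have I: "independent_set (co_strip v T V) I" "card I = 3"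
    by (auto simp: config_graph_def)
  from I(2) obtain p q r where pqr: "I = {p, q, r}" "p \<noteq> q" "q \<noteq> r" "p \<noteq> r"
    by (auto simp: card_3_iff)
  have "strip_adj v T x y" if "x \<in> I" "y \<in> I" "x \<noteq> y" for x y
    using that I(1) by (auto simp: independent_set_def co_strip_def)
  with pqr triangle[of p q r] show "I \<in> strip_triangle v ` {..<T}"
    by blast
next
  fix I assume "I \<in> strip_triangle v ` {..<T}"
  then obtain t where t: "t < T" "I = {v t, v (t + 1), v (t + 2)}"
    by (auto simp: strip_triangle_def)
  have ne: "v t \<noteq> v (t + 1)" "v (t + 1) \<noteq> v (t + 2)" "v t \<noteq> v (t + 2)"
    using proper[of 1 t] proper[of 1 "t + 1"] proper[of 2 t] t by auto
  have adj: "strip_adj v T (v t) (v (t + 1))" "strip_adj v T (v (t + 1)) (v (t + 2))"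
    "strip_adj v T (v t) (v (t + 2))"
    using strip_adjI1[of t T v] strip_adjI1[of "t + 1" T v] strip_adjI2[of t T v] t by auto
  have "I \<subseteq> V" using t range by auto
  moreover have "(x, y) \<notin> parcs (co_strip v T V)" if "x \<in> I" "y \<in> I" for x y
    using that adj adj[THEN strip_adj_sym[THEN iffD1]] t(2) by (auto simp: co_strip_def)
  ultimately have "independent_set (co_strip v T V) I"
    by (auto simp: independent_set_def co_strip_def)
  moreover have "card I = 3" using ne t(2) by simp
  ultimately show "I \<in> pverts R" by (simp add: config_graph_def)
qed

text \<open>The edges of the triangle at \<open>t\<close> start at \<open>t\<close>,
  \<open>t\<close> and \<open>t + 1\<close>, so an edge locates the triangles containing it up to
  one step.\<close>

lemma strip_triangle_pair:
  assumes "p \<in> strip_triangle v t" "q \<in> strip_triangle v t" "p \<noteq> q" "t < T"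
  obtains s d where "t \<le> s" "s \<le> t + 1" "d \<in> {1, 2}" "s + d < T + 2" "{p, q} = {v s, v (s + d)}"
proof -
  have "{p, q} = {v t, v (t + 1)} \<or> {p, q} = {v (t + 1), v (t + 1 + 1)} \<or> {p, q} = {v t, v (t + 2)}"
    using assms by (auto simp: strip_triangle_def)
  then show ?thesis
    using that[of t 1] that[of "t + 1" 1] that[of t 2] assms by auto
qed

text \<open>The shared edge has only one starting index: at most \<open>s + 1\<close> as an edge of
  the old triangle, at least \<open>t\<close> as an edge of the new one.\<close>

lemma parcs_R_step:
  assumes "(strip_triangle v s, J) \<in> parcs R" "s < T"
  obtains t where "t < T" "J = strip_triangle v t" "t \<le> s + 1"
proof -
  have "J \<in> pverts R" and c: "card (strip_triangle v s \<inter> J) = 2"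
    using assms(1) by (auto simp: config_graph_def)
  then obtain t where t: "t < T" "J = strip_triangle v t"
    using pverts_R by auto
  from c obtain p q where pq: "p \<noteq> q" "strip_triangle v s \<inter> J = {p, q}"
    by (auto simp: card_2_iff)
  then have "p \<in> strip_triangle v s" "q \<in> strip_triangle v s"
    "p \<in> strip_triangle v t" "q \<in> strip_triangle v t"
    using t by auto
  then obtain x d y e where "x \<le> s + 1" "d \<in> {1, 2}" "x + d < T + 2" "{p, q} = {v x, v (x + d)}"
    "t \<le> y" "e \<in> {1, 2}" "y + e < T + 2" "{p, q} = {v y, v (y + e)}"
    using strip_triangle_pair pq(1) t(1) assms(2) by metis
  then have "t \<le> s + 1" using edge_unique[of d e x y] by simp
  with t that show ?thesis by blast
qed

lemma parcs_R_Suc: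
  assumes "Suc t < T"
  shows "(strip_triangle v t, strip_triangle v (Suc t)) \<in> parcs R"
proof -
  have ne: "v t \<noteq> v (t + 1)" "v (t + 1) \<noteq> v (t + 2)" "v t \<noteq> v (t + 2)"
    using proper[of 1 t] proper[of 1 "t + 1"] proper[of 2 t] assms by auto
  \<comment> \<open>Otherwise the edge from \<open>t + 1\<close> to \<open>t + 3\<close> would
    repeat the edge from \<open>t\<close> to \<open>t + 1\<close>.\<close>
  moreover have "v t \<noteq> v (t + 3)"
    using edge_unique[of 1 2 t "t + 1"] assms by (auto simp: numeral_3_eq_3 insert_commute)
  ultimately have "strip_triangle v t \<inter> strip_triangle v (Suc t) = {v (t + 1), v (t + 2)}"
    by (auto simp: strip_triangle_def numeral_3_eq_3)
  then have "card (strip_triangle v t \<inter> strip_triangle v (Suc t)) = 2"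
    using ne by simp
  moreover have "strip_triangle v t \<in> pverts R" "strip_triangle v (Suc t) \<in> pverts R"
    using pverts_R assms by auto
  ultimately show ?thesis by (simp add: config_graph_def)
qed

lemma strip_triangle_inj:
  assumes "strip_triangle v s = strip_triangle v t" "s < T" "t < T"
  shows "s = t"
proof -
  have *: "s \<le> t" if st: "strip_triangle v s = strip_triangle v t" "s < T" "t < T" for s t
  proof -
    have "v t \<in> strip_triangle v s" "v (t + 1) \<in> strip_triangle v s"
      unfolding st(1) by (simp_all add: strip_triangle_def)
    moreover have "v t \<noteq> v (t + 1)" using proper[of 1 t] st by simp
    ultimately obtain x d where "s \<le> x" "d \<in> {1, 2}" "x + d < T + 2"
      "{v t, v (t + 1)} = {v x, v (x + d)}"
      using st(2) by (rule strip_triangle_pair)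
    then show ?thesis using edge_unique[of 1 d t x] st by simp
  qed
  show ?thesis using *[OF assms] *[OF assms(1)[symmetric] assms(3,2)] by simp
qed

text \<open>All triangles of the strip lie in the component of the first one, and a step raises the
  index by at most one, so every walk from index \<open>0\<close> to \<open>T - 1\<close> has at
  least \<open>T - 1\<close> arcs.\<close>

theorem ex_scc_diameter:
  "\<exists>H\<in>pre_digraph.sccs (with_proj R). graph_diameter H \<ge> ereal (real (T - 1))"
proof -
  interpret R: pair_graph R by (rule pair_graph_R)
  let ?S = "R.scc_of (strip_triangle v 0)"
  let ?H = "with_proj R \<restriction> ?S"
  have vert: "strip_triangle v t \<in> pverts R" if "t < T" for t
    using pverts_R that by auto
  have reach: "strip_triangle v 0 \<rightarrow>\<^sup>*\<^bsub>with_proj R\<^esub> strip_triangle v t" if "t < T" for t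
    using that
  proof (induction t)
    case 0
    then show ?case using vert by (simp add: R.reachable_refl)
  next
    case (Suc t)
    have "strip_triangle v t \<rightarrow>\<^bsub>with_proj R\<^esub> strip_triangle v (Suc t)"
      using parcs_R_Suc[OF Suc.prems] by simp
    with Suc.IH Suc.prems show ?case by (auto intro: R.reachable_adj_trans)
  qed
  have inS: "strip_triangle v t \<in> ?S" if "t < T" for t
    using reach[OF that] by (rule R.scc_ofI_reachable')
  have H: "?H \<in> R.sccs"
    using R.scc_of_in_sccs_verts[of "strip_triangle v 0"] vert[of 0] pos
    by (simp add: R.in_sccs_verts_conv)
  interpret H: wf_digraph ?H
    by (rule R.wellformed_induce_subgraph)
  have far: "\<exists>t<T. J = strip_triangle v t \<and> t \<le> s + length p"
    if "H.awalk (strip_triangle v s) p J" "s < T" for s p J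
    using that
  proof (induction p arbitrary: s)
    case Nil
    then show ?case by (auto simp: H.awalk_Nil_iff)
  next
    case (Cons e p)
    then have e: "e \<in> parcs R" "fst e = strip_triangle v s" "H.awalk (snd e) p J"
      by (auto simp: H.awalk_Cons_iff)
    then have "(strip_triangle v s, snd e) \<in> parcs R" by (cases e) simp
    then obtain t where t: "t < T" "snd e = strip_triangle v t" "t \<le> s + 1"
      using Cons.prems(2) by (rule parcs_R_step)
    with Cons.IH[of t] e obtain u where "u < T" "J = strip_triangle v u" "u \<le> t + length p" by auto
    with t show ?case by (intro exI[of _ u]) simp
  qed
  have cost: "H.awalk_cost (\<lambda>_. 1) p = real (length p)" for p
    by (induction p) auto
  have "ereal (real (T - 1)) \<le> H.\<mu> (\<lambda>_. 1) (strip_triangle v 0) (strip_triangle v (T - 1))"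
    unfolding H.\<mu>_def
  proof (rule INF_greatest)
    fix p assume "p \<in> {p. H.awalk (strip_triangle v 0) p (strip_triangle v (T - 1))}"
    then obtain t where "t < T" "strip_triangle v (T - 1) = strip_triangle v t" "t \<le> length p"
      using far[of 0 p "strip_triangle v (T - 1)"] pos by auto
    moreover from this have "T - 1 = t" using strip_triangle_inj pos by simp
    ultimately show "ereal (real (T - 1)) \<le> ereal (H.awalk_cost (\<lambda>_. 1) p)"
      by (simp add: cost)
  qed
  also have "\<dots> \<le> graph_diameter ?H"
    unfolding graph_diameter_def using inS[of 0] inS[of "T - 1"] pos
    by (intro SUP_upper2[of "strip_triangle v 0"] SUP_upper2[of "strip_triangle v (T - 1)"]) simp_all
  finally show ?thesis using H by blast
qed

end

lemma max_config_diameter_ge_strip: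
  assumes "strip v T {..<n}"
  shows "max_config_diameter n 3 \<ge> ereal (real (T - 1))"
proof -
  interpret strip v T "{..<n}" by fact
  obtain H where H: "H \<in> pre_digraph.sccs (with_proj R)" "graph_diameter H \<ge> ereal (real (T - 1))"
    using ex_scc_diameter by blast
  have "pair_graph (co_strip v T {..<n})" "card (pverts (co_strip v T {..<n})) = n"
    using pair_graph_co_strip[OF fin] by (simp_all add: co_strip_def)
  then show ?thesis
    unfolding max_config_diameter_def
    by (intro SUP_upper2[of "co_strip v T {..<n}"] SUP_upper2[OF H(1)] H(2)) auto
qed

section \<open>The strip of a progression-free sequence\<close>

text \<open>
  For \<open>t = 3 (N i + j) + r\<close> the value is \<open>3 (j + 4 r a\<^sub>i) + r\<close>, so the residue modulo 3 tells the
  three classes of the tripartite graph apart. For fixed \<open>i\<close> the strip runs through the triangles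
  with class coordinates \<open>(j, j + 4 a\<^sub>i, j + 8 a\<^sub>i)\<close>; from \<open>j = N - 1\<close> it jumps to \<open>j = 0\<close> of the
  next \<open>i\<close>.
\<close>

definition twisted :: "nat \<Rightarrow> (nat \<Rightarrow> nat) \<Rightarrow> nat \<Rightarrow> nat" where
  "twisted N a t = 3 * ((t div 3) mod N + 4 * (t mod 3) * a (t div 3 div N)) + t mod 3"

text \<open>
  With \<open>N\<close> much larger than all \<open>a\<^sub>i\<close>, the edges at a jump differ too much in their coordinates to
  form triangles with the ordinary edges.
\<close>

locale ap3_free_seq =
  fixes M N q :: nat and a :: "nat \<Rightarrow> nat"
  assumes N: "N = 20 * M"
    and a_less: "i < q \<Longrightarrow> a i < M"
    and ap3: "\<lbrakk>i < q; k < q; l < q; a i + a k = 2 * a l\<rbrakk> \<Longrightarrow> i = k"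
    and q: "0 < q"
begin

section \<open>Coordinates along the twisted sequence\<close>

lemma M_pos: "1 \<le> M"
  using a_less[OF q] by simp

lemma a_inj: "\<lbrakk>a i = a k; i < q; k < q\<rbrakk> \<Longrightarrow> i = k"
  using ap3[of i k k] by simp

lemma index_less: "\<lbrakk>i < q; j < N\<rbrakk> \<Longrightarrow> N * i + j < N * q"
proof -
  assume "i < q" "j < N"
  then have "N * i + j < N * Suc i" by simp
  also have "\<dots> \<le> N * q" using \<open>i < q\<close> by (intro mult_le_mono2) simp
  finally show ?thesis .
qed

lemma twisted_eq:
  assumes "j < N" "r < 3"
  shows "twisted N a (3 * (N * i + j) + r) = 3 * (j + 4 * r * a i) + r"
proof -
  have "(3 * (N * i + j) + r) div 3 = N * i + j" "(3 * (N * i + j) + r) mod 3 = r"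
    using assms(2) by presburger+
  then show ?thesis using assms(1) by (simp add: twisted_def)
qed

lemma twisted_next:
  assumes "j + 1 < N" "r < 3"
  shows "twisted N a (3 * (N * i + j) + 3 + r) = 3 * (j + 1 + 4 * r * a i) + r"
  using twisted_eq[of "j + 1" r i] assms by (simp add: algebra_simps)

lemma twisted_wrap:
  assumes "j + 1 = N" "r < 3"
  shows "twisted N a (3 * (N * i + j) + 3 + r) = 3 * (4 * r * a (i + 1)) + r"
proof -
  have "3 * (N * i + j) + 3 + r = 3 * (N * (i + 1) + 0) + r" using assms(1) by simp
  then show ?thesis using twisted_eq[of 0 r "i + 1"] assms N by (simp only:) simp
qed

text \<open>
  Here \<open>E\<^sub>r\<^sub>s t x y\<close> says that one of the two strip edges starting at index \<open>t\<close> joins the vertices \<open>3 x + r\<close> and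
  \<open>3 y + s\<close>.
\<close>

definition E01 :: "nat \<Rightarrow> nat \<Rightarrow> nat \<Rightarrow> bool" where
  "E01 t x y \<longleftrightarrow> (\<exists>i<q. \<exists>j<N. y = j + 4 * a i \<and>
     (t = 3 * (N * i + j) \<and> x = j \<or> t = 3 * (N * i + j) + 1 \<and>
       (j + 1 < N \<and> x = j + 1 \<or> j + 1 = N \<and> i + 1 < q \<and> x = 0)))"

text \<open>Call the indices with the same \<open>(i, j)\<close> a column and those with the same
  \<open>i\<close> a block. The class 2 end lies in column \<open>(i, j)\<close>, the class 1 end in
  that column or the following one; at a jump the latter depends on
  \<open>a (i + 1)\<close>.\<close>

definition E12 :: "nat \<Rightarrow> nat \<Rightarrow> nat \<Rightarrow> bool" where
  "E12 t y z \<longleftrightarrow> (\<exists>i<q. \<exists>j<N. z = j + 8 * a i \<and>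
     (t = 3 * (N * i + j) + 1 \<and> y = j + 4 * a i \<or> t = 3 * (N * i + j) + 2 \<and>
       (j + 1 < N \<and> y = j + 1 + 4 * a i \<or> j + 1 = N \<and> i + 1 < q \<and> y = 4 * a (i + 1))))"

definition E02 :: "nat \<Rightarrow> nat \<Rightarrow> nat \<Rightarrow> bool" where
  "E02 t x z \<longleftrightarrow> (\<exists>i<q. \<exists>j<N. z = j + 8 * a i \<and>
     (t = 3 * (N * i + j) \<and> x = j \<or> t = 3 * (N * i + j) + 2 \<and>
       (j + 1 < N \<and> x = j + 1 \<or> j + 1 = N \<and> i + 1 < q \<and> x = 0)))"

section \<open>No edge occurs twice\<close>

lemma E01_unique:
  assumes "E01 t x y" "E01 t' x y"
  shows "t = t'"
proof -
  obtain i j where 1: "i < q" "j < N" "y = j + 4 * a i"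
    "t = 3 * (N * i + j) \<and> x = j \<or> t = 3 * (N * i + j) + 1 \<and>
       (j + 1 < N \<and> x = j + 1 \<or> j + 1 = N \<and> i + 1 < q \<and> x = 0)"
    using assms(1) unfolding E01_def by blast
  obtain i' j' where 2: "i' < q" "j' < N" "y = j' + 4 * a i'"
    "t' = 3 * (N * i' + j') \<and> x = j' \<or> t' = 3 * (N * i' + j') + 1 \<and>
       (j' + 1 < N \<and> x = j' + 1 \<or> j' + 1 = N \<and> i' + 1 < q \<and> x = 0)"
    using assms(2) unfolding E01_def by blast
  note b = N M_pos a_less[OF 1(1)] a_less[OF 2(1)]
  \<comment> \<open>The difference \<open>y - x\<close> is \<open>4 * a i\<close>, or
    \<open>4 * a i - 1\<close>, or \<open>N - 1 + 4 * a i\<close> at a jump. The first two differ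
    modulo 4, and the last exceeds both ranges since \<open>N = 20 * M\<close>.\<close>
  have "a i = a i'" using 1(3,4) 2(3,4) b by (elim disjE conjE) linarith+
  then have "i' = i" using a_inj[of i i'] 1 2 by simp
  with 1 2 b show ?thesis by (elim disjE conjE) (simp_all, linarith?)
qed

lemma E12_unique:
  assumes "E12 t y z" "E12 t' y z"
  shows "t = t'"
proof -
  obtain i j where 1: "i < q" "j < N" "z = j + 8 * a i"
    "t = 3 * (N * i + j) + 1 \<and> y = j + 4 * a i \<or> t = 3 * (N * i + j) + 2 \<and>
       (j + 1 < N \<and> y = j + 1 + 4 * a i \<or> j + 1 = N \<and> i + 1 < q \<and> y = 4 * a (i + 1))"
    using assms(1) unfolding E12_def by blast
  obtain i' j' where 2: "i' < q" "j' < N" "z = j' + 8 * a i'"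
    "t' = 3 * (N * i' + j') + 1 \<and> y = j' + 4 * a i' \<or> t' = 3 * (N * i' + j') + 2 \<and>
       (j' + 1 < N \<and> y = j' + 1 + 4 * a i' \<or> j' + 1 = N \<and> i' + 1 < q \<and> y = 4 * a (i' + 1))"
    using assms(2) unfolding E12_def by blast
  note b = N M_pos a_less[OF 1(1)] a_less[OF 2(1)]
  have y1: "y = j + 4 * a i \<or> y = j + 1 + 4 * a i \<or> (j + 1 = N \<and> y < 4 * M)"
    using 1(4) a_less[of "i + 1"] by auto
  have y2: "y = j' + 4 * a i' \<or> y = j' + 1 + 4 * a i' \<or> (j' + 1 = N \<and> y < 4 * M)"
    using 2(4) a_less[of "i' + 1"] by auto
  \<comment> \<open>Ordinary differences \<open>z - y\<close> are again \<open>4 * a i\<close> or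
    \<open>4 * a i - 1\<close>; at a jump \<open>y < 4 * M\<close> and \<open>z \<ge> N - 1\<close>
    make the difference too large for that. Two jumps have the same \<open>j\<close>, so
    \<open>z\<close> determines \<open>a i\<close>.\<close>
  have "a i = a i'" using 1(3) 2(3) y1 y2 b by (elim disjE conjE) linarith+
  then have i: "i' = i" "j' = j" using a_inj[of i i'] 1(1-3) 2(1-3) by simp_all
  have "\<not> (j + 1 = N \<and> i + 1 < q \<and> j + 4 * a i = 4 * a (i + 1))"
    using a_less[of "i + 1"] b by linarith
  with 1(4) 2(4) show ?thesis unfolding i by auto
qed

lemma E02_unique:
  assumes "E02 t x z" "E02 t' x z"
  shows "t = t'"
proof -
  obtain i j where 1: "i < q" "j < N" "z = j + 8 * a i"
    "t = 3 * (N * i + j) \<and> x = j \<or> t = 3 * (N * i + j) + 2 \<and>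
       (j + 1 < N \<and> x = j + 1 \<or> j + 1 = N \<and> i + 1 < q \<and> x = 0)"
    using assms(1) unfolding E02_def by blast
  obtain i' j' where 2: "i' < q" "j' < N" "z = j' + 8 * a i'"
    "t' = 3 * (N * i' + j') \<and> x = j' \<or> t' = 3 * (N * i' + j') + 2 \<and>
       (j' + 1 < N \<and> x = j' + 1 \<or> j' + 1 = N \<and> i' + 1 < q \<and> x = 0)"
    using assms(2) unfolding E02_def by blast
  note b = N M_pos a_less[OF 1(1)] a_less[OF 2(1)]
  \<comment> \<open>The possible differences \<open>z - x\<close> are \<open>8 * a i\<close>,
    \<open>8 * a i - 1\<close> and, at a jump, \<open>N - 1 + 8 * a i\<close>.\<close>
  have "a i = a i'" using 1(3,4) 2(3,4) b by (elim disjE conjE) linarith+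
  then have "i' = i" "j' = j" using a_inj[of i i'] 1 2 by simp_all
  with 1(4) 2(4) b show ?thesis by (elim disjE conjE) (simp_all, linarith?)
qed

section \<open>Indices of the strip and the edges they give\<close>

definition T :: nat where "T = 3 * (N * q) - 2"

lemma N_ge: "20 \<le> N"
  using N M_pos by simp

lemma T_add_2: "T + 2 = 3 * (N * q)"
proof -
  have "1 * 1 \<le> N * q" using N_ge q by (intro mult_le_mono) auto
  then show ?thesis unfolding T_def by linarith
qed

text \<open>Triangles starting in class 1 or 2 reach into the next column, which must exist in the
  same block or open a further one.\<close>

lemma T_bound:
  assumes "i < q" "j < N"
  shows "3 * (N * i + j) < T" and "i + 1 < q \<Longrightarrow> 3 * (N * i + j) + 2 < T" 
    and "j + 1 < N \<Longrightarrow> 3 * (N * i + j) + 2 < T"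
proof -
  show "3 * (N * i + j) < T" using index_less[OF assms] T_add_2 by presburger
  show "3 * (N * i + j) + 2 < T" if "i + 1 < q"
  proof -
    have "N * i + N < N * q" using index_less[of "i + 1" 0] that N_ge by simp
    then show ?thesis using assms(2) T_add_2 by presburger
  qed
  show "3 * (N * i + j) + 2 < T" if "j + 1 < N"
  proof -
    have "N * i + j + 1 < N * q" using index_less[of i "j + 1"] that assms by simp
    then show ?thesis using T_add_2 by presburger
  qed
qed

lemma indexE:
  assumes "t < T + 2"
  obtains i j r where "i < q" "j < N" "r < 3" "t = 3 * (N * i + j) + r"
proof -
  have "t div 3 < N * q" using assms T_add_2 by (simp add: less_mult_imp_div_less mult.commute)
  then have "t div 3 div N < q" by (simp add: less_mult_imp_div_less mult.commute)
  moreover have "t div 3 mod N < N" "t mod 3 < 3" using N_ge by simp_all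
  moreover have "t = 3 * (N * (t div 3 div N) + t div 3 mod N) + t mod 3" by simp
  ultimately show ?thesis using that by blast
qed

lemma twisted_edge:
  assumes d: "d \<in> {1, 2}" and t: "t + d < T + 2"
  shows "(\<exists>x y. E01 t x y \<and> {twisted N a t, twisted N a (t + d)} = {3 * x, 3 * y + 1}) \<or>
    (\<exists>y z. E12 t y z \<and> {twisted N a t, twisted N a (t + d)} = {3 * y + 1, 3 * z + 2}) \<or>
    (\<exists>x z. E02 t x z \<and> {twisted N a t, twisted N a (t + d)} = {3 * x, 3 * z + 2})"
    (is "?A \<or> ?B \<or> ?C")
proof -
  from t have "t < T + 2" by simp
  then obtain i j r where ij: "i < q" "j < N" "r < 3" and t_eq: "t = 3 * (N * i + j) + r"
    by (rule indexE)
  have wt: "twisted N a t = 3 * (j + 4 * r * a i) + r"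
    unfolding t_eq by (rule twisted_eq[OF ij(2,3)])
  \<comment> \<open>An edge that leaves the last column of a block ends in the next block, and in
    the last block its end would lie beyond the strip.\<close>
  have wrap: "i + 1 < q" if "j + 1 = N" "3 \<le> r + d"
  proof (rule ccontr)
    assume "\<not> i + 1 < q"
    then have "q = i + 1" using ij by simp
    then have "N * q = N * i + N" by simp
    then show False using t T_add_2 that unfolding t_eq by presburger
  qed
  \<comment> \<open>The case names give the classes of the two ends in walking order; in
    \<open>10\<close>, \<open>20\<close> and \<open>21\<close> the edge passes to the next
    column.\<close>
  consider (01) "r = 0" "d = 1" | (02) "r = 0" "d = 2" | (12) "r = 1" "d = 1"
    | (10) "r = 1" "d = 2" | (20) "r = 2" "d = 1" | (21) "r = 2" "d = 2"
  proof -
    have "r = 0 \<or> r = 1 \<or> r = 2" using ij(3) by linarith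
    with d that show ?thesis by blast
  qed
  then show ?thesis
  proof cases
    case 01
    have "twisted N a (t + d) = 3 * (j + 4 * a i) + 1"
      using twisted_eq[of j 1 i] ij unfolding t_eq 01 by simp
    moreover have "E01 t j (j + 4 * a i)" using ij t_eq 01 by (auto simp: E01_def)
    ultimately have ?A using wt 01 by (intro exI[of _ j] exI[of _ "j + 4 * a i"]) simp
    then show ?thesis ..
  next
    case 02
    have "twisted N a (t + d) = 3 * (j + 8 * a i) + 2"
      using twisted_eq[of j 2 i] ij unfolding t_eq 02 by simp
    moreover have "E02 t j (j + 8 * a i)" using ij t_eq 02 by (auto simp: E02_def)
    ultimately have ?C using wt 02 by (intro exI[of _ j] exI[of _ "j + 8 * a i"]) simp
    then show ?thesis by blast
  next
    case 12
    have "twisted N a (t + d) = 3 * (j + 8 * a i) + 2"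
      using twisted_eq[of j 2 i] ij unfolding t_eq 12 by (simp add: add.assoc)
    moreover have "E12 t (j + 4 * a i) (j + 8 * a i)" using ij t_eq 12 by (auto simp: E12_def)
    ultimately have ?B using wt 12 by (intro exI[of _ "j + 4 * a i"] exI[of _ "j + 8 * a i"]) simp
    then show ?thesis by blast
  next
    case 10
    define x where "x = (if j + 1 < N then j + 1 else 0)"
    have "twisted N a (t + d) = 3 * x"
      using twisted_next[of j 0 i] twisted_wrap[of j 0 i] ij unfolding t_eq 10 x_def
      by (auto simp: add.assoc numeral_3_eq_3)
    moreover have "E01 t x (j + 4 * a i)"
      unfolding E01_def using ij t_eq 10 wrap by (intro exI[of _ i] exI[of _ j]) (auto simp: x_def)
    ultimately have ?A using wt 10 by (intro exI[of _ x] exI[of _ "j + 4 * a i"]) auto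
    then show ?thesis ..
  next
    case 20
    define x where "x = (if j + 1 < N then j + 1 else 0)"
    have "twisted N a (t + d) = 3 * x"
      using twisted_next[of j 0 i] twisted_wrap[of j 0 i] ij unfolding t_eq 20 x_def
      by (auto simp: add.assoc numeral_3_eq_3)
    moreover have "E02 t x (j + 8 * a i)"
      unfolding E02_def using ij t_eq 20 wrap by (intro exI[of _ i] exI[of _ j]) (auto simp: x_def)
    ultimately have ?C using wt 20 by (intro exI[of _ x] exI[of _ "j + 8 * a i"]) auto
    then show ?thesis by blast
  next
    case 21
    define y where "y = (if j + 1 < N then j + 1 + 4 * a i else 4 * a (i + 1))"
    have "t + d = 3 * (N * i + j) + 3 + 1" unfolding t_eq 21 by simp
    then have "twisted N a (t + d) = 3 * y + 1"
      using twisted_next[of j 1 i] twisted_wrap[of j 1 i] ij unfolding y_def by auto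
    moreover have "E12 t y (j + 8 * a i)"
      unfolding E12_def using ij t_eq 21 wrap by (intro exI[of _ i] exI[of _ j]) (auto simp: y_def)
    ultimately have ?B using wt 21 by (intro exI[of _ y] exI[of _ "j + 8 * a i"]) auto
    then show ?thesis by blast
  qed
qed


section \<open>Triangles formed by the edges of the strip\<close>

abbreviation w :: "nat \<Rightarrow> nat" where "w \<equiv> twisted N a"

lemma strip_adj_cases:
  assumes "strip_adj w T u v"
  obtains x y t where "E01 t x y" "{u, v} = {3 * x, 3 * y + 1}"
  | y z t where "E12 t y z" "{u, v} = {3 * y + 1, 3 * z + 2}"
  | x z t where "E02 t x z" "{u, v} = {3 * x, 3 * z + 2}"
proof -
  obtain t d where td: "d \<in> {1, 2}" "t + d < T + 2" and uv: "{u, v} = {w t, w (t + d)}"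
    using assms unfolding strip_adj_def by blast
  show ?thesis using twisted_edge[OF td] unfolding uv[symmetric] using that by blast
qed

text \<open>Residues modulo 3 tell the two ends of an edge apart, so unordered pairs compare
  coordinatewise. Both orientations of the inequations are listed for rewriting.\<close>

lemma residue_pairs:
  "{3 * x, 3 * y + 1} = {3 * x', 3 * y' + 1} \<longleftrightarrow> x = x' \<and> y = y'"
  "{3 * y + 1, 3 * z + 2} = {3 * y' + 1, 3 * z' + 2} \<longleftrightarrow> y = y' \<and> z = z'"
  "{3 * x, 3 * z + 2} = {3 * x', 3 * z' + 2} \<longleftrightarrow> x = x' \<and> z = z'"
  "{3 * x, 3 * y + 1} \<noteq> {3 * y' + 1, 3 * z' + 2}"
  "{3 * x, 3 * y + 1} \<noteq> {3 * x', 3 * z' + 2}"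
  "{3 * y + 1, 3 * z + 2} \<noteq> {3 * x', 3 * z' + 2}"
  "{3 * y' + 1, 3 * z' + 2} \<noteq> {3 * x, 3 * y + 1}"
  "{3 * x', 3 * z' + 2} \<noteq> {3 * x, 3 * y + 1}"
  "{3 * x', 3 * z' + 2} \<noteq> {3 * y + 1, 3 * z + 2}"
  for x x' y y' z z' :: nat
proof -
  have ne: "3 * i \<noteq> 3 * k + 1" "3 * i \<noteq> 3 * k + 2" "3 * i + 1 \<noteq> 3 * k + 2"
    "3 * k + 1 \<noteq> 3 * i" "3 * k + 2 \<noteq> 3 * i" "3 * k + 2 \<noteq> 3 * i + 1" for i k :: nat
    by presburger+
  have inj: "3 * i = 3 * k \<longleftrightarrow> i = k" "3 * i + 1 = 3 * k + 1 \<longleftrightarrow> i = k"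
    "3 * i + 2 = 3 * k + 2 \<longleftrightarrow> i = k" for i k :: nat
    by simp_all
  show
    "{3 * x, 3 * y + 1} = {3 * x', 3 * y' + 1} \<longleftrightarrow> x = x' \<and> y = y'"
    "{3 * y + 1, 3 * z + 2} = {3 * y' + 1, 3 * z' + 2} \<longleftrightarrow> y = y' \<and> z = z'"
    "{3 * x, 3 * z + 2} = {3 * x', 3 * z' + 2} \<longleftrightarrow> x = x' \<and> z = z'"
    "{3 * x, 3 * y + 1} \<noteq> {3 * y' + 1, 3 * z' + 2}"
    "{3 * x, 3 * y + 1} \<noteq> {3 * x', 3 * z' + 2}"
    "{3 * y + 1, 3 * z + 2} \<noteq> {3 * x', 3 * z' + 2}"
    "{3 * y' + 1, 3 * z' + 2} \<noteq> {3 * x, 3 * y + 1}"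
    "{3 * x', 3 * z' + 2} \<noteq> {3 * x, 3 * y + 1}"
    "{3 * x', 3 * z' + 2} \<noteq> {3 * y + 1, 3 * z + 2}"
    unfolding doubleton_eq_iff by (simp_all only: ne inj simp_thms)
qed

lemma strip_adj_mod: "strip_adj w T u v \<Longrightarrow> u mod 3 \<noteq> v mod 3"
  by (erule strip_adj_cases; unfold doubleton_eq_iff; elim disjE conjE; presburger)

lemma strip_adj_01: "strip_adj w T (3 * x) (3 * y + 1) \<Longrightarrow> \<exists>t. E01 t x y"
  by (erule strip_adj_cases; simp only: residue_pairs; blast)

lemma strip_adj_12: "strip_adj w T (3 * y + 1) (3 * z + 2) \<Longrightarrow> \<exists>t. E12 t y z"
  by (erule strip_adj_cases; simp only: residue_pairs; blast)

lemma strip_adj_02: "strip_adj w T (3 * x) (3 * z + 2) \<Longrightarrow> \<exists>t. E02 t x z"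
  by (erule strip_adj_cases; simp only: residue_pairs; blast)

lemma edge_index_unique:
  assumes "d \<in> {1, 2}" "e \<in> {1, 2}" "s + d < T + 2" "t + e < T + 2"
    and "{w s, w (s + d)} = {w t, w (t + e)}"
  shows "s = t"
  using twisted_edge[OF assms(1,3)] twisted_edge[OF assms(2,4)] unfolding assms(5)
  by (elim disjE exE conjE; simp only: residue_pairs)
    (auto dest: E01_unique E12_unique E02_unique)

text \<open>The three edges come from columns \<open>(i1, j1)\<close>, \<open>(i, j)\<close> and
  \<open>(i3, j3)\<close>. If the edge between classes 1 and 2 is a jump, sizes force the triangle;
  otherwise progression-freeness identifies the blocks.\<close>

lemma triangle_in_strip:
  assumes "strip_adj w T (3 * x) (3 * y + 1)" "strip_adj w T (3 * y + 1) (3 * z + 2)"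
    and "strip_adj w T (3 * x) (3 * z + 2)"
  shows "\<exists>t<T. {3 * x, 3 * y + 1, 3 * z + 2} = strip_triangle w t"
proof -
  obtain i1 j1 where 1: "i1 < q" "j1 < N" "y = j1 + 4 * a i1"
    "x = j1 \<or> j1 + 1 < N \<and> x = j1 + 1 \<or> j1 + 1 = N \<and> i1 + 1 < q \<and> x = 0"
    using strip_adj_01[OF assms(1)] unfolding E01_def by blast
  obtain i j where 2: "i < q" "j < N" "z = j + 8 * a i"
    "y = j + 4 * a i \<or> j + 1 < N \<and> y = j + 1 + 4 * a i \<or>
      j + 1 = N \<and> i + 1 < q \<and> y = 4 * a (i + 1)"
    using strip_adj_12[OF assms(2)] unfolding E12_def by blast
  obtain i3 j3 where 3: "i3 < q" "j3 < N" "z = j3 + 8 * a i3"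
    "x = j3 \<or> j3 + 1 < N \<and> x = j3 + 1 \<or> j3 + 1 = N \<and> i3 + 1 < q \<and> x = 0"
    using strip_adj_02[OF assms(3)] unfolding E02_def by blast
  note b = N M_pos a_less[OF 1(1)] a_less[OF 2(1)] a_less[OF 3(1)]
  let ?t = "3 * (N * i + j)"
  have w0: "w ?t = 3 * j" "w (?t + 1) = 3 * (j + 4 * a i) + 1" "w (?t + 2) = 3 * (j + 8 * a i) + 2"
    using twisted_eq[of j 0 i] twisted_eq[of j 1 i] twisted_eq[of j 2 i] 2(2) by simp_all
  have four: "?t + 4 = ?t + 3 + 1" by simp
  have w1: "w (?t + 3) = 3 * (j + 1)" "w (?t + 4) = 3 * (j + 1 + 4 * a i) + 1" if "j + 1 < N"
    using twisted_next[OF that, of 0 i] twisted_next[OF that, of 1 i] by (simp_all only: four) simp_all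
  have w2: "w (?t + 3) = 0" "w (?t + 4) = 3 * (4 * a (i + 1)) + 1" if "j + 1 = N"
    using twisted_wrap[OF that, of 0 i] twisted_wrap[OF that, of 1 i] by (simp_all only: four) simp_all
  have triangles: "strip_triangle w t = {w t, w (t + 1), w (t + 2)}"
    "strip_triangle w (t + 1) = {w (t + 3), w (t + 1), w (t + 2)}"
    "strip_triangle w (t + 2) = {w (t + 3), w (t + 4), w (t + 2)}" for t
    by (auto simp: strip_triangle_def eval_nat_numeral)
  note bound = T_bound[OF 2(1,2)]
  consider (wrap) "j + 1 = N" "i + 1 < q" "y = 4 * a (i + 1)"
    | (reg) "y = j + 4 * a i \<or> j + 1 < N \<and> y = j + 1 + 4 * a i"
    using 2(4) by blast
  then show ?thesis
  proof cases
    case wrap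
    \<comment> \<open>The edge from \<open>x\<close> to \<open>y\<close> keeps \<open>x\<close>
      below \<open>4 * M\<close>, since \<open>y < 4 * M\<close>. But \<open>z \<ge> N - 1\<close>
      gives \<open>j3 > 12 * M\<close>, so the edge from \<open>x\<close> to \<open>z\<close> must
      be a jump.\<close>
    have "x = 0"
      using 1(3,4) 2(3) 3(3,4) wrap(1,3) a_less[OF wrap(2)] b by (elim disjE conjE) linarith+
    then have "{3 * x, 3 * y + 1, 3 * z + 2} = strip_triangle w (?t + 2)"
      unfolding triangles(3) w0 w2[OF wrap(1)] wrap(3) 2(3) by simp
    then show ?thesis using bound(2)[OF wrap(2)] by blast
  next
    case reg
    \<comment> \<open>Around the triangle the class differences add up to \<open>4 a + 4 a' = 8 a''\<close> with an error of
      at most 2 in absolute value, which vanishes as both sides are divisible by 4.\<close>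
    have "a i1 + a i = 2 * a i3"
      using 1(3,4) 2(3) 3(3,4) reg b by (elim disjE conjE) linarith+
    then have "i1 = i" using ap3 1(1) 2(1) 3(1) by blast
    moreover from this \<open>a i1 + a i = 2 * a i3\<close> have "a i3 = a i" by simp
    then have "i3 = i" using a_inj 2(1) 3(1) by blast
    ultimately have i: "i1 = i" "i3 = i" by simp_all
    have j3: "j3 = j" using 2(3) 3(3) i by simp
    \<comment> \<open>With the column fixed, what remains is which of \<open>x\<close> and
      \<open>y\<close> have moved on to the next column: none, \<open>x\<close> alone, or both.
      \<open>N_ge\<close> excludes a jump in a block of two columns.\<close>
    consider (first) "x = j" "y = j + 4 * a i" | (second) "j + 1 < N" "x = j + 1" "y = j + 4 * a i"
      | (second_wrap) "j + 1 = N" "i + 1 < q" "x = 0" "y = j + 4 * a i"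
      | (third) "j + 1 < N" "x = j + 1" "y = j + 1 + 4 * a i"
      using 1 3(4) reg N_ge unfolding i j3 by linarith
    then show ?thesis
    proof cases
      case first
      then show ?thesis using bound(1) triangles(1)[of ?t] w0 2(3) by auto
    next
      case second
      then have "{3 * x, 3 * y + 1, 3 * z + 2} = strip_triangle w (?t + 1)"
        unfolding triangles(2) w0 w1[OF second(1)] 2(3) by simp
      then show ?thesis using bound(3)[OF second(1)] by (intro exI[of _ "?t + 1"]) simp
    next
      case second_wrap
      then have "{3 * x, 3 * y + 1, 3 * z + 2} = strip_triangle w (?t + 1)"
        unfolding triangles(2) w0 w2[OF second_wrap(1)] 2(3) by simp
      then show ?thesis using bound(2)[OF second_wrap(2)] by (intro exI[of _ "?t + 1"]) simp
    next
      case third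
      then have "{3 * x, 3 * y + 1, 3 * z + 2} = strip_triangle w (?t + 2)"
        unfolding triangles(3) w0 w1[OF third(1)] 2(3) by simp
      then show ?thesis using bound(3)[OF third(1)] by blast
    qed
  qed
qed

text \<open>Coordinates stay below \<open>N + 8 * M = 28 * M\<close>, and the three classes triple
  this to \<open>84 * M\<close>.\<close>

lemma twisted_strip:
  assumes n: "84 * M \<le> n"
  shows "strip w T {..<n}"
proof
  show "0 < T" using T_bound(1)[of 0 0] q N_ge by simp
  show "w t \<in> {..<n}" if t: "t < T + 2" for t
  proof -
    obtain i j r where "i < q" "j < N" "r < 3" "t = 3 * (N * i + j) + r"
      using t by (rule indexE)
    note ij = this
    define s where "s = r * a i"
    have "s \<le> 2 * a i" unfolding s_def using ij(3) by (intro mult_right_mono) simp_all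
    moreover have "a i < M" using ij(1) by (rule a_less)
    moreover have "w t = 3 * (j + 4 * s) + r"
      using twisted_eq[OF ij(2,3), of i] ij(4) by (simp add: s_def mult.assoc)
    moreover have "3 * j + 3 \<le> 60 * M" using ij(2) N by simp
    ultimately have "w t < n" using ij(3) n by (simp add: algebra_simps)
    then show ?thesis by simp
  qed
  show "w t \<noteq> w (t + d)" if "d \<in> {1, 2}" "t + d < T + 2" for t d
  proof -
    have "strip_adj w T (w t) (w (t + d))" unfolding strip_adj_def using that by blast
    then show ?thesis by (auto dest: strip_adj_mod)
  qed
  show "\<exists>t<T. {p, q', r} = strip_triangle w t"
    if "strip_adj w T p q'" "strip_adj w T q' r" "strip_adj w T p r" for p q' r
  proof -
    define I where "I = {p, q', r}"
    have adj: "strip_adj w T u v" if "u \<in> I" "v \<in> I" "u \<noteq> v" for u v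
      using that \<open>strip_adj w T p q'\<close> \<open>strip_adj w T q' r\<close> \<open>strip_adj w T p r\<close>
      unfolding I_def by (auto simp: strip_adj_sym)
    \<comment> \<open>Adjacent vertices have different residues, so a triangle has one vertex in
      each class and can be listed in class order.\<close>
    have "(\<lambda>u. u mod 3) ` I = {0, 1, 2}"
    proof (rule card_seteq[symmetric, THEN sym])
      have "p mod 3 \<noteq> q' mod 3" "q' mod 3 \<noteq> r mod 3" "p mod 3 \<noteq> r mod 3"
        using that strip_adj_mod by blast+
      then show "card {0, 1, 2 :: nat} \<le> card ((\<lambda>u. u mod 3) ` I)" by (simp add: I_def)
      show "(\<lambda>u. u mod 3) ` I \<subseteq> {0, 1, 2}" by (auto simp: less_Suc_eq)
    qed simp
    then have "0 \<in> (\<lambda>u. u mod 3) ` I" "1 \<in> (\<lambda>u. u mod 3) ` I" "2 \<in> (\<lambda>u. u mod 3) ` I" by simp_all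
    then obtain u0 u1 u2 where u: "u0 \<in> I" "u1 \<in> I" "u2 \<in> I" "u0 mod 3 = 0" "u1 mod 3 = 1" "u2 mod 3 = 2"
      by (auto simp: image_iff)
    define x y z where "x = u0 div 3" and "y = u1 div 3" and "z = u2 div 3"
    have u_eq: "u0 = 3 * x" "u1 = 3 * y + 1" "u2 = 3 * z + 2"
      unfolding x_def y_def z_def using u(4-6) by presburger+
    have ne: "u0 \<noteq> u1" "u1 \<noteq> u2" "u0 \<noteq> u2" using u(4-6) by auto
    have "{u0, u1, u2} = I"
    proof (rule card_seteq)
      show "card I \<le> card {u0, u1, u2}" using ne by (simp add: I_def card_insert_le_m1)
    qed (use u in \<open>auto simp: I_def\<close>)
    moreover have "\<exists>t<T. {u0, u1, u2} = strip_triangle w t"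
      unfolding u_eq by (rule triangle_in_strip) (use adj u ne u_eq in auto)
    ultimately show ?thesis by (simp add: I_def)
  qed
  show "s = t" if "d \<in> {1, 2}" "e \<in> {1, 2}" "s + d < T + 2" "t + e < T + 2"
    "{w s, w (s + d)} = {w t, w (t + e)}" for s t d e
    using that by (rule edge_index_unique)
qed simp

end

section \<open>Progression-free sets\<close>

definition ap3_free :: "nat set \<Rightarrow> bool" where
  "ap3_free A \<longleftrightarrow> (\<forall>a\<in>A. \<forall>b\<in>A. \<forall>c\<in>A. a + b = 2 * c \<longrightarrow> a = b)"

section \<open>Digit expansions and Behrend's construction\<close>

lemma digit_expansion_unique:
  fixes f g :: "nat \<Rightarrow> nat" and k B :: nat
  assumes "(\<Sum>i<k. f i * B ^ i) = (\<Sum>i<k. g i * B ^ i)"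
    and "\<And>i. i < k \<Longrightarrow> f i < B" "\<And>i. i < k \<Longrightarrow> g i < B" and "i < k"
  shows "f i = g i"
  using assms
proof (induction k arbitrary: f g i)
  case (Suc k)
  have shift: "(\<Sum>i<Suc k. h i * B ^ i) = h 0 + B * (\<Sum>i<k. h (Suc i) * B ^ i)" for h :: "nat \<Rightarrow> nat"
    by (subst sum.lessThan_Suc_shift) (simp add: sum_distrib_left mult_ac)
  have B: "f 0 < B" "g 0 < B" using Suc.prems by auto
  have eq: "f 0 + B * (\<Sum>i<k. f (Suc i) * B ^ i) = g 0 + B * (\<Sum>i<k. g (Suc i) * B ^ i)"
    using Suc.prems(1) by (simp only: shift)
  have "f 0 = g 0" using arg_cong[OF eq, of "\<lambda>x. x mod B"] B by simp
  moreover have "f (Suc j) = g (Suc j)" if "j < k" for j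
  proof (rule Suc.IH[of "\<lambda>i. f (Suc i)" "\<lambda>i. g (Suc i)"])
    show "(\<Sum>i<k. f (Suc i) * B ^ i) = (\<Sum>i<k. g (Suc i) * B ^ i)"
      using eq \<open>f 0 = g 0\<close> B by simp
  qed (use that Suc.prems in auto)
  ultimately show ?case using Suc.prems(4) by (cases i) auto
qed simp

lemma digit_expansion_less:
  fixes f :: "nat \<Rightarrow> nat"
  assumes "\<And>i. i < k \<Longrightarrow> f i < B"
  shows "(\<Sum>i<k. f i * B ^ i) < B ^ k"
  using assms
proof (induction k)
  case (Suc k)
  have "(\<Sum>i<Suc k. f i * B ^ i) < B ^ k + f k * B ^ k" using Suc by simp
  also have "\<dots> = Suc (f k) * B ^ k" by simp
  also have "\<dots> \<le> B * B ^ k" using Suc.prems[of k] by (intro mult_right_mono) auto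
  finally show ?case by simp
qed simp

text \<open>
  Digits below \<open>d\<close> in base \<open>2 d\<close> add without carries, so progressions of numbers are progressions
  of vectors, and a sphere contains no midpoint of two of its points.
\<close>

lemma ap3_free_sphere:
  fixes d k R :: nat
  defines "S \<equiv> {x \<in> {..<k} \<rightarrow>\<^sub>E {..<d}. (\<Sum>i<k. (x i)\<^sup>2) = R}"
    and "\<phi> \<equiv> \<lambda>x. \<Sum>i<k. x i * (2 * d) ^ i"
  shows "ap3_free (\<phi> ` S)" "inj_on \<phi> S" "\<phi> ` S \<subseteq> {..<(2 * d) ^ k}"
proof -
  have dig: "x i < d" if "x \<in> S" "i < k" for x i
    using that by (auto simp: S_def)
  then have dig': "x i < 2 * d" if "x \<in> S" "i < k" for x i
    using that by fastforce
  show "ap3_free (\<phi> ` S)"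
    unfolding ap3_free_def
  proof (clarify)
    fix x y z assume S: "x \<in> S" "y \<in> S" "z \<in> S" and eq: "\<phi> x + \<phi> y = 2 * \<phi> z"
    have sums: "(\<Sum>i<k. (x i + y i) * (2 * d) ^ i) = (\<Sum>i<k. 2 * z i * (2 * d) ^ i)"
      using eq by (simp add: \<phi>_def sum.distrib distrib_right sum_distrib_left mult.assoc)
    have lt: "x i + y i < 2 * d" "2 * z i < 2 * d" if "i < k" for i
      using dig[OF S(1) that] dig[OF S(2) that] dig[OF S(3) that] by auto
    have mid: "x i + y i = 2 * z i" if "i < k" for i
      by (rule digit_expansion_unique[OF sums]) (use lt that in auto)
    have nrm: "(\<Sum>i<k. (int (u i))\<^sup>2) = int R" if "u \<in> S" for u
    proof -
      have "int (\<Sum>i<k. (u i)\<^sup>2) = int R" using that unfolding S_def by blast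
      then show ?thesis by (simp only: of_nat_sum of_nat_power)
    qed
    \<comment> \<open>The parallelogram identity with \<open>x + y = 2 * z\<close>; since all three
      points have squared norm \<open>R\<close>, the right side vanishes.\<close>
    have "(\<Sum>i<k. (int (x i) - int (y i))\<^sup>2)
        = (\<Sum>i<k. 2 * (int (x i))\<^sup>2 + 2 * (int (y i))\<^sup>2 - 4 * (int (z i))\<^sup>2)"
    proof (rule sum.cong[OF refl])
      fix i assume "i \<in> {..<k}"
      then have "int (x i) + int (y i) = 2 * int (z i)" using mid[of i] by simp
      then have "(int (x i) + int (y i))\<^sup>2 = (2 * int (z i))\<^sup>2" by (simp only:)
      then show "(int (x i) - int (y i))\<^sup>2 = 2 * (int (x i))\<^sup>2 + 2 * (int (y i))\<^sup>2 - 4 * (int (z i))\<^sup>2"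
        by (simp add: power2_sum power2_diff power_mult_distrib)
    qed
    also have "\<dots> = 2 * int R + 2 * int R - 4 * int R"
      by (simp add: sum_subtractf sum.distrib sum_distrib_left[symmetric] nrm S)
    finally have "(\<Sum>i<k. (int (x i) - int (y i))\<^sup>2) = 0" by simp
    then have "\<forall>i<k. x i = y i"
      by (subst (asm) sum_nonneg_eq_0_iff) auto
    then show "\<phi> x = \<phi> y" by (simp add: \<phi>_def)
  qed
  show "inj_on \<phi> S"
  proof (rule inj_onI)
    fix x y assume S: "x \<in> S" "y \<in> S" and eq: "\<phi> x = \<phi> y"
    show "x = y"
    proof (rule PiE_ext[of x "{..<k}" "\<lambda>_. {..<d}"])
      fix i assume "i \<in> {..<k}"
      then show "x i = y i"
        using digit_expansion_unique[OF eq[unfolded \<phi>_def] dig'[OF S(1)] dig'[OF S(2)]] by simp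
    qed (use S in \<open>auto simp: S_def\<close>)
  qed
  show "\<phi> ` S \<subseteq> {..<(2 * d) ^ k}"
    using digit_expansion_less[OF dig'] unfolding \<phi>_def by (intro image_subsetI) (simp only: lessThan_iff)
qed

text \<open>
  Behrend's bound \<open>card A \<ge> M / 2 ^ (4 k)\<close> for \<open>M = 2 ^ (k (k + 1))\<close>: pigeonhole over the spheres in
  a box with side \<open>2 ^ k\<close> and dimension \<open>k\<close>.
\<close>

lemma behrend:
  obtains A where "A \<subseteq> {..<2 ^ (k * (k + 1))}" "ap3_free A" "2 ^ (k * k) \<le> card A * 2 ^ (3 * k)"
proof -
  define d :: nat where "d = 2 ^ k"
  let ?P = "{..<k} \<rightarrow>\<^sub>E {..<d}"
  define S where "S R = {x \<in> ?P. (\<Sum>i<k. (x i)\<^sup>2) = R}" for R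
  define \<phi> where "\<phi> x = (\<Sum>i<k. x i * (2 * d) ^ i)" for x
  have fin: "finite ?P" by (simp add: finite_PiE)
  have bound: "(\<Sum>i<k. (x i)\<^sup>2) \<le> k * d\<^sup>2" if "x \<in> ?P" for x
  proof -
    have "x i < d" if "i < k" for i using \<open>x \<in> ?P\<close> that by auto
    then have "(\<Sum>i<k. (x i)\<^sup>2) \<le> (\<Sum>i<k. d\<^sup>2)"
      by (intro sum_mono power_mono) (auto intro: less_imp_le)
    then show ?thesis by simp
  qed
  \<comment> \<open>Counts the possible squared norms \<open>0\<close>, ...,
    \<open>k * d\<^sup>2\<close>, using \<open>k + 1 \<le> 2 ^ k\<close>.\<close>
  have few: "Suc (k * d\<^sup>2) \<le> 2 ^ (3 * k)"
  proof -
    have "Suc (k * d\<^sup>2) \<le> (k + 1) * d\<^sup>2" by (simp add: d_def)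
    also have "\<dots> \<le> 2 ^ k * d\<^sup>2"
      using Suc_leI[OF less_exp[of k]] by (intro mult_right_mono) simp_all
    also have "\<dots> = 2 ^ (3 * k)" by (simp add: d_def power_mult[symmetric] power_add[symmetric])
    finally show ?thesis .
  qed
  have "\<exists>R. 2 ^ (k * k) \<le> card (S R) * 2 ^ (3 * k)"
  proof (rule ccontr)
    assume "\<nexists>R. 2 ^ (k * k) \<le> card (S R) * 2 ^ (3 * k)"
    then have small: "card (S R) * 2 ^ (3 * k) < 2 ^ (k * k)" for R by (simp add: not_le)
    have "?P \<subseteq> (\<Union>R\<in>{..k * d\<^sup>2}. S R)" using bound by (auto simp: S_def)
    then have "card ?P \<le> card (\<Union>R\<in>{..k * d\<^sup>2}. S R)"
      using fin by (intro card_mono) (auto simp: S_def)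
    also have "\<dots> \<le> (\<Sum>R\<le>k * d\<^sup>2. card (S R))" by (rule card_UN_le) simp
    finally have "2 ^ (k * k) * 2 ^ (3 * k) \<le> (\<Sum>R\<le>k * d\<^sup>2. card (S R)) * 2 ^ (3 * k)"
      by (simp add: card_PiE d_def power_mult)
    also have "\<dots> = (\<Sum>R\<le>k * d\<^sup>2. card (S R) * 2 ^ (3 * k))" by (simp add: sum_distrib_right)
    also have "\<dots> < (\<Sum>R\<le>k * d\<^sup>2. 2 ^ (k * k))" using small by (intro sum_strict_mono) auto
    also have "\<dots> = Suc (k * d\<^sup>2) * 2 ^ (k * k)" by simp
    also have "\<dots> \<le> 2 ^ (3 * k) * 2 ^ (k * k)" using few by (rule mult_right_mono) simp
    finally show False by (simp add: mult.commute)
  qed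
  then obtain R where R: "2 ^ (k * k) \<le> card (S R) * 2 ^ (3 * k)" ..
  have "(2 * d) ^ k = 2 ^ (k * (k + 1))"
    by (simp add: d_def power_mult_distrib power_mult[symmetric] power_add[symmetric] algebra_simps)
  moreover note ap3_free_sphere[of d k R, folded S_def \<phi>_def[abs_def]]
  ultimately show ?thesis
    using that[of "\<phi> ` S R"] R by (simp add: card_image)
qed

section \<open>The lower bound\<close>

lemma max_config_diameter_ge_ap3_free:
  assumes A: "A \<subseteq> {..<M}" "ap3_free A" "A \<noteq> {}" and n: "84 * M \<le> n"
  shows "max_config_diameter n 3 \<ge> ereal (real (20 * M * card A))"
proof -
  have fin: "finite A" using A(1) finite_subset by blast
  obtain a where a: "bij_betw a {0..<card A} A"
    using ex_bij_betw_nat_finite[OF fin] by blast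
  then have mem: "a i \<in> A" if "i < card A" for i
    using that by (auto simp: bij_betw_def)
  interpret ap3_free_seq M "20 * M" "card A" a
  proof
    show "0 < card A" using fin A(3) by (simp add: card_gt_0_iff)
    show "a i < M" if "i < card A" for i using mem[OF that] A(1) by auto
    show "i = k" if "i < card A" "k < card A" "l < card A" "a i + a k = 2 * a l" for i k l
    proof -
      have "a i = a k" using A(2) mem that unfolding ap3_free_def by blast
      then show ?thesis using a that by (auto simp: bij_betw_def inj_on_def)
    qed
  qed simp
  \<comment> \<open>Here \<open>T - 1 = 60 * M * card A - 3\<close>; giving up two thirds of the
    main term absorbs the 3.\<close>
  have "20 * 1 \<le> 20 * M * card A" using N_ge q by (intro mult_le_mono) auto
  then have "20 * M * card A \<le> T - 1"
    unfolding T_def by linarith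
  then have "ereal (real (20 * M * card A)) \<le> ereal (real (T - 1))"
    by (simp only: ereal_less_eq of_nat_le_iff)
  also have "\<dots> \<le> max_config_diameter n 3"
    by (rule max_config_diameter_ge_strip[OF twisted_strip[OF n]])
  finally show ?thesis .
qed

text \<open>Serves \<open>n < 84\<close>, where \<open>84 * M \<le> n\<close> leaves no positive
  \<open>M\<close>: the walk 0, 1, 2, 3 is a strip with two triangles.\<close>

lemma max_config_diameter_ge_1:
  assumes "4 \<le> n"
  shows "max_config_diameter n 3 \<ge> 1"
proof -
  have adj: "p < 4 \<and> q < 4 \<and> (p = q + 1 \<or> p = q + 2 \<or> q = p + 1 \<or> q = p + 2)"
    if "strip_adj (\<lambda>t. t) 2 p q" for p q :: nat
    using that unfolding strip_adj_def doubleton_eq_iff by auto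
  have "strip (\<lambda>t. t) 2 {..<n}"
  proof
    show "\<exists>t<2. {p, q, r} = strip_triangle (\<lambda>t. t) t"
      if "strip_adj (\<lambda>t. t) 2 p q" "strip_adj (\<lambda>t. t) 2 q r" "strip_adj (\<lambda>t. t) 2 p r" for p q r :: nat
    proof -
      let ?S = "{p, q, r}"
      have "p \<noteq> q" "q \<noteq> r" "p \<noteq> r" and "?S \<subseteq> {..<4}" and "0 \<notin> ?S \<or> 3 \<notin> ?S"
        using adj[OF that(1)] adj[OF that(2)] adj[OF that(3)] by auto
      \<comment> \<open>0 and 3 are not adjacent, so a triangle misses one of them.\<close>
      then have card: "card ?S = 3" and sub: "?S \<subseteq> {0, 1, 2} \<or> ?S \<subseteq> {1, 2, 3}"
        by (auto simp: numeral_eq_Suc less_Suc_eq)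
      have "?S = {0, 1, 2}" if "?S \<subseteq> {0, 1, 2}"
        by (rule card_seteq[OF _ that]) (simp_all only: card, simp_all)
      moreover have "?S = {1, 2, 3}" if "?S \<subseteq> {1, 2, 3}"
        by (rule card_seteq[OF _ that]) (simp_all only: card, simp_all)
      moreover have "strip_triangle (\<lambda>t. t) 0 = {0, 1, 2}" "strip_triangle (\<lambda>t. t) 1 = {1, 2, 3}"
        by (simp_all add: strip_triangle_def eval_nat_numeral)
      ultimately have "?S = strip_triangle (\<lambda>t. t) 0 \<or> ?S = strip_triangle (\<lambda>t. t) 1"
        using sub by argo
      then show ?thesis by (meson one_less_numeral_iff semiring_norm(76) zero_less_numeral)
    qed
    show "s = t" if "d \<in> {1, 2}" "e \<in> {1, 2}" "{s, s + d} = {t, t + e}" for s t d e :: nat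
      using that unfolding doubleton_eq_iff by linarith
  qed (use assms in auto)
  then show ?thesis using max_config_diameter_ge_strip[of "\<lambda>t. t" 2 n] by (simp add: one_ereal_def)
qed

text \<open>Behrend's set with \<open>M = 2 ^ (k * (k + 1))\<close>: the exponent
  \<open>2 * k * k + k\<close> combines \<open>k * (k + 1)\<close> from \<open>M\<close> and
  \<open>k * k\<close> from the box.\<close>

lemma max_config_diameter_ge_power:
  assumes "84 * 2 ^ (k * (k + 1)) \<le> n"
  shows "max_config_diameter n 3 \<ge> ereal (20 * 2 ^ (2 * k * k + k) / 2 ^ (3 * k))"
proof -
  obtain A where A: "A \<subseteq> {..<2 ^ (k * (k + 1))}" "ap3_free A" "2 ^ (k * k) \<le> card A * 2 ^ (3 * k)"
    by (rule behrend)
  have "A \<noteq> {}" using A(3) by (auto simp: not_le)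
  have "(2 :: real) ^ (k * k) \<le> real (card A) * 2 ^ (3 * k)"
    using of_nat_mono[OF A(3), where 'a = real] by simp
  then have "(2 :: real) ^ (k * k) / 2 ^ (3 * k) \<le> real (card A)"
    by (simp add: field_simps)
  then have "20 * 2 ^ (k * (k + 1)) * (2 ^ (k * k) / 2 ^ (3 * k)) \<le> 20 * 2 ^ (k * (k + 1)) * real (card A)"
    by (intro mult_left_mono) simp_all
  moreover have "(2 :: real) ^ (2 * k * k + k) = 2 ^ (k * (k + 1)) * 2 ^ (k * k)"
    by (simp add: power_add[symmetric] algebra_simps)
  ultimately have "20 * 2 ^ (2 * k * k + k) / 2 ^ (3 * k) \<le> real (20 * 2 ^ (k * (k + 1)) * card A)"
    by simp
  then show ?thesis
    using max_config_diameter_ge_ap3_free[OF A(1,2) \<open>A \<noteq> {}\<close> assms] by (meson ereal_less_eq(3) order_trans)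
qed

text \<open>Taking logarithms gives \<open>k * k * ln 2 \<le> ln n\<close>. As
  \<open>ln 2 < 1\<close>, also \<open>(k * ln 2)\<^sup>2 \<le> ln n\<close>.\<close>

lemma two_power_le_exp_sqrt_ln:
  fixes k n :: nat
  assumes "2 ^ (k * k) \<le> n"
  shows "(2 :: real) ^ (8 * k) \<le> exp (8 * sqrt (ln (real n)))"
proof -
  have n: "1 \<le> n" using assms by (meson le_trans one_le_numeral one_le_power)
  have "real k * real k * ln 2 = ln (2 ^ (k * k))" by (simp add: ln_realpow)
  also have "\<dots> \<le> ln (real n)"
    using of_nat_mono[OF assms, where 'a = real] n by simp
  finally have k: "real k * real k * ln 2 \<le> ln (real n)" .
  have "(real k * ln 2)\<^sup>2 = (real k * real k * ln 2) * ln 2" by (simp add: power2_eq_square)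
  also have "\<dots> \<le> (real k * real k * ln 2) * 1"
    using ln_2_less_1 by (intro mult_left_mono) simp_all
  finally have "real k * ln 2 \<le> sqrt (ln (real n))"
    using k by (intro real_le_rsqrt) simp
  then have "exp (real (8 * k) * ln 2) \<le> exp (8 * sqrt (ln (real n)))" by simp
  then show ?thesis by (simp only: exp_of_nat_mult exp_ln zero_less_numeral)
qed

theorem mainTheorem2:
  "\<exists>c C :: real. c > 0 \<and> C > 0 \<and>
     (\<forall>n::nat. n \<ge> 4 \<longrightarrow>
        max_config_diameter n 3 \<ge>
          ereal (c * (real n ^ 2 / exp (C * sqrt (ln (real n))))))"
\<comment> \<open>\<open>7056 = 84\<^sup>2\<close>. The constant 8 is 3 + 5:
  \<open>2 ^ (3 * k)\<close> is lost to pigeonhole and \<open>2 ^ (5 * k)\<close> to rounding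
  \<open>n\<close> down to an admissible size.\<close>
proof (rule exI[of _ "1 / 7056"], rule exI[of _ 8], intro conjI allI impI)
  fix n :: nat assume n: "4 \<le> n"
  let ?E = "exp (8 * sqrt (ln (real n)))"
  have E: "1 \<le> ?E" using n by simp
  show "ereal (1 / 7056 * (real n ^ 2 / ?E)) \<le> max_config_diameter n 3"
  proof (cases "n < 84")
    case True
    \<comment> \<open>For small \<open>n\<close> the constant makes the claimed bound at most
      1.\<close>
    then have "real n ^ 2 \<le> 84 ^ 2" by (intro power_mono) simp_all
    moreover have "real n ^ 2 / ?E \<le> real n ^ 2 / 1" using E by (intro divide_left_mono) simp_all
    ultimately have "real n ^ 2 / ?E \<le> 7056" by simp
    then have "1 / 7056 * (real n ^ 2 / ?E) \<le> 1" by linarith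
    then have "ereal (1 / 7056 * (real n ^ 2 / ?E)) \<le> 1" by (simp add: one_ereal_def)
    then show ?thesis using max_config_diameter_ge_1[OF n] by (rule order_trans)
  next
    case False
    define P where "P k \<longleftrightarrow> 84 * 2 ^ (k * (k + 1)) \<le> n" for k
    have bound: "k \<le> n" if "P k" for k
    proof -
      have "k < 2 ^ k" by (rule less_exp)
      also have "(2 :: nat) ^ k \<le> 84 * 2 ^ (k * (k + 1))"
        by (rule order_trans[OF power_increasing[of k "k * (k + 1)"]]) simp_all
      finally show ?thesis using that unfolding P_def by linarith
    qed
    \<comment> \<open>The largest dimension that fits; failure at \<open>k + 1\<close> bounds
      \<open>n\<close> from above.\<close>
    define k where "k = Greatest P"
    have "P 0" using False by (simp add: P_def)
    then have "P k" unfolding k_def using bound by (rule GreatestI_nat)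
    have "\<not> P (k + 1)"
    proof
      assume "P (k + 1)"
      then have "k + 1 \<le> k" unfolding k_def using bound by (rule Greatest_le_nat)
      then show False by simp
    qed
    then have "n \<le> 84 * 2 ^ ((k + 1) * (k + 2))" by (simp add: P_def)
    then have "real n \<le> 84 * 2 ^ ((k + 1) * (k + 2))"
      using of_nat_mono[where 'a = real] by fastforce
    then have "real n ^ 2 \<le> (84 * 2 ^ ((k + 1) * (k + 2))) ^ 2" by (intro power_mono) simp_all
    also have "\<dots> = 7056 * 16 * 2 ^ (2 * k * k + k) * 2 ^ (5 * k)"
    proof -
      \<comment> \<open>\<open>2 * (k + 1) * (k + 2) = (2 * k * k + k) + 5 * k + 4\<close>; the 4
        gives the factor 16, later absorbed by 20.\<close>
      have "((2 :: real) ^ ((k + 1) * (k + 2))) ^ 2 = 2 ^ 4 * 2 ^ (2 * k * k + k) * 2 ^ (5 * k)"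
        unfolding power_mult[symmetric] power_add[symmetric] by (rule arg_cong[of _ _ "power 2"]) (simp add: algebra_simps)
      then show ?thesis by (simp only: power_mult_distrib) simp
    qed
    finally have n2: "real n ^ 2 \<le> 7056 * 16 * 2 ^ (2 * k * k + k) * 2 ^ (5 * k)" .
    have "(2 :: nat) ^ (k * k) \<le> 84 * 2 ^ (k * (k + 1))"
      by (rule order_trans[OF power_increasing[of "k * k" "k * (k + 1)"]]) simp_all
    with \<open>P k\<close> have "2 ^ (k * k) \<le> n" by (simp add: P_def)
    then have "real n ^ 2 / ?E \<le> real n ^ 2 / 2 ^ (8 * k)"
      by (intro divide_left_mono two_power_le_exp_sqrt_ln) simp_all
    also have "\<dots> \<le> 7056 * 16 * 2 ^ (2 * k * k + k) * 2 ^ (5 * k) / 2 ^ (8 * k)"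
      using n2 by (rule divide_right_mono) simp
    also have "\<dots> = 7056 * 16 * 2 ^ (2 * k * k + k) / 2 ^ (3 * k)"
    proof -
      have "(2 :: real) ^ (8 * k) = 2 ^ (5 * k) * 2 ^ (3 * k)" by (simp add: power_add[symmetric])
      then show ?thesis by simp
    qed
    also have "\<dots> \<le> 7056 * (20 * 2 ^ (2 * k * k + k) / 2 ^ (3 * k))"
      by (simp add: field_simps)
    finally have "1 / 7056 * (real n ^ 2 / ?E) \<le> 20 * 2 ^ (2 * k * k + k) / 2 ^ (3 * k)" by simp
    then have "ereal (1 / 7056 * (real n ^ 2 / ?E)) \<le> ereal (20 * 2 ^ (2 * k * k + k) / 2 ^ (3 * k))"
      by simp
    then show ?thesis
      using max_config_diameter_ge_power[OF \<open>P k\<close>[unfolded P_def]] by (rule order_trans)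
  qed
qed simp_all

end
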